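(* Let $X$ be a complex Banach space and let $T: X \to X$ be a bounded linear operator that is power compact, i.e. $T^k$ is a compact operator for some integer $k \ge 1$. Let $\lambda$ be a non-zero complex number which is not an eigenvalue of $T$. Then the operator $T - \lambda$ (that is, $T-\lambda\,\mathrm{Id}$) has a bounded inverse $(T - \lambda)^{-1}$ defined on all of $X$.
   Context: A bounded linear operator $T$ on a Banach space $X$ is called power compact if there is an integer $k\ge 1$ such that $T^k$ is compact. An eigenvalue of $T$ is a complex number $\lambda$ such that $(T-\lambda)x=0$ for some $x\in X\setminus\{0\}$. *)

theory Defs
  imports "HOL-Analysis.Analysis"
begin

text \<open>
  HOL-Analysis only has real normed spaces. A complex Banach space is a real Banach space with a
  complex scalar multiplication that extends the real one and for which the norm is absolutely
  homogeneous.
\<close>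

class complex_banach = banach +
  fixes scaleC :: "complex \<Rightarrow> 'a \<Rightarrow> 'a" (infixr "*\<^sub>C" 75)
  assumes scaleC_add_right: "a *\<^sub>C (x + y) = a *\<^sub>C x + a *\<^sub>C y"
    and scaleC_add_left: "(a + b) *\<^sub>C x = a *\<^sub>C x + b *\<^sub>C x"
    and scaleC_scaleC: "a *\<^sub>C b *\<^sub>C x = (a * b) *\<^sub>C x"
    and scaleC_one: "1 *\<^sub>C x = x"
    and scaleC_of_real: "complex_of_real r *\<^sub>C x = r *\<^sub>R x"
    and norm_scaleC: "norm (a *\<^sub>C x) = cmod a * norm x"

instantiation complex :: complex_banach
begin

definition scaleC_complex :: "complex \<Rightarrow> complex \<Rightarrow> complex"
  where "scaleC_complex a x = a * x"

instance
  by standard (simp_all add: scaleC_complex_def algebra_simps norm_mult scaleR_conv_of_real)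

end

text \<open>The library's \<open>bounded_linear\<close> is real linearity together with boundedness.\<close>

definition bounded_clinear :: "('a::complex_banach \<Rightarrow> 'b::complex_banach) \<Rightarrow> bool"
  where "bounded_clinear T \<longleftrightarrow> bounded_linear T \<and> (\<forall>c x. T (c *\<^sub>C x) = c *\<^sub>C T x)"

definition compact_operator :: "('a::complex_banach \<Rightarrow> 'b::complex_banach) \<Rightarrow> bool"
  where "compact_operator T \<longleftrightarrow>
    bounded_clinear T \<and> (\<forall>B. bounded B \<longrightarrow> compact (closure (T ` B)))"

definition power_compact :: "('a::complex_banach \<Rightarrow> 'a) \<Rightarrow> bool"
  where "power_compact T \<longleftrightarrow> bounded_clinear T \<and> (\<exists>k\<ge>1. compact_operator (T ^^ k))"

definition shifted :: "('a::complex_banach \<Rightarrow> 'a) \<Rightarrow> complex \<Rightarrow> 'a \<Rightarrow> 'a"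
  where "shifted T \<mu> = (\<lambda>x. T x - \<mu> *\<^sub>C x)"

definition eigenvalue :: "('a::complex_banach \<Rightarrow> 'a) \<Rightarrow> complex \<Rightarrow> bool"
  where "eigenvalue T \<mu> \<longleftrightarrow> (\<exists>x. x \<noteq> 0 \<and> shifted T \<mu> x = 0)"

definition has_bounded_inverse :: "('a::complex_banach \<Rightarrow> 'b::complex_banach) \<Rightarrow> bool"
  where "has_bounded_inverse A \<longleftrightarrow>
    (\<exists>S. bounded_clinear S \<and> S \<circ> A = id \<and> A \<circ> S = id)"

end

theory Submission
  imports Defs
begin

text \<open>
  Write \<open>A = T - \<mu>\<close>. Since \<open>T ^ k - \<mu> ^ k\<close> is divisible by \<open>A\<close>, the compact operator
  \<open>K = \<mu> ^ (-k) T ^ k\<close> has the form \<open>K = 1 + A Q\<close> with a bounded \<open>Q\<close> commuting with \<open>A\<close>. If \<open>A\<close>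
  were not bounded below, unit vectors \<open>x n\<close> with \<open>A (x n) \<rightarrow> 0\<close> would satisfy
  \<open>K (x n) - x n \<rightarrow> 0\<close>, so a subsequence would converge to a unit vector in the kernel of \<open>A\<close>.
  If \<open>A\<close> were not surjective, the ranges of the powers \<open>A ^ n\<close> would form a strictly decreasing
  sequence of closed subspaces; Riesz's lemma picks unit vectors \<open>x n\<close> in the \<open>n\<close>-th range at
  distance at least \<open>1/2\<close> from the next one, and \<open>K (x n)\<close> has no Cauchy subsequence because
  \<open>K (x n) - K (x m)\<close> differs from \<open>x n\<close> by an element of the next range whenever \<open>n < m\<close>.
\<close>

text \<open>Take \<open>y\<close> in \<open>V\<close> outside \<open>S\<close> and \<open>s0\<close>
  in \<open>S\<close> whose distance from \<open>y\<close> is less than twice the distance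
  \<open>d\<close> from \<open>y\<close> to \<open>S\<close>; normalising \<open>y - s0\<close>
  gives the vector, and the factor 2 becomes the bound 1/2.\<close>

lemma Riesz_lemma:
  fixes S V :: "'a::real_normed_vector set"
  assumes "closed S" "subspace S" "subspace V" "S \<subset> V"
  obtains x where "x \<in> V" "norm x = 1" "\<And>s. s \<in> S \<Longrightarrow> norm (x - s) \<ge> 1/2"
proof -
  from assms obtain y where y: "y \<in> V" "y \<notin> S" by blast
  have ne: "S \<noteq> {}" using assms subspace_0 by blast
  define d where "d = infdist y S"
  have d: "d > 0"
    unfolding d_def using assms(1) ne y(2) infdist_pos_not_in_closed by blast
  have "\<exists>s0\<in>S. dist y s0 < 2 * d"
  proof (rule ccontr)
    assume "\<not> ?thesis"
    then have "2 * d \<le> infdist y S"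
      unfolding infdist_notempty[OF ne] by (intro cINF_greatest[OF ne]) (auto simp: not_less)
    then show False using d d_def by simp
  qed
  then obtain s0 where s0: "s0 \<in> S" "dist y s0 < 2 * d" by blast
  define c where "c = norm (y - s0)"
  have c: "c > 0" "c < 2 * d" using y s0 by (auto simp: c_def dist_norm)
  show thesis
  proof
    show "(y - s0) /\<^sub>R c \<in> V"
      using y s0 assms by (intro subspace_scale subspace_diff) auto
    show "norm ((y - s0) /\<^sub>R c) = 1" using c by (simp add: c_def)
    fix s assume s: "s \<in> S"
    then have "s0 + c *\<^sub>R s \<in> S" using s0 assms by (intro subspace_add subspace_scale) auto
    then have "d \<le> norm (y - (s0 + c *\<^sub>R s))"
      unfolding d_def dist_norm[symmetric] by (rule infdist_le)
    also have "y - (s0 + c *\<^sub>R s) = c *\<^sub>R ((y - s0) /\<^sub>R c - s)"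
      using c by (simp add: algebra_simps)
    also have "norm \<dots> = c * norm ((y - s0) /\<^sub>R c - s)" using c by simp
    finally have "d \<le> c * norm ((y - s0) /\<^sub>R c - s)" .
    moreover have "c * (1/2) < d" using c by simp
    ultimately have "c * (1/2) < c * norm ((y - s0) /\<^sub>R c - s)" by linarith
    then show "1/2 \<le> norm ((y - s0) /\<^sub>R c - s)" using c by simp
  qed
qed

lemma funpow_commutes:
  assumes "\<And>x. f (g x) = g (f x)"
  shows "f ((g ^^ n) x) = (g ^^ n) (f x)"
  by (induction n) (simp_all add: assms)

lemma bounded_linear_funpow:
  fixes f :: "'a::real_normed_vector \<Rightarrow> 'a"
  assumes "bounded_linear f"
  shows "bounded_linear (f ^^ n)"
proof (induction n)
  case 0
  show ?case by (simp add: id_def bounded_linear_ident)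
next
  case (Suc n)
  then show ?case using bounded_linear_compose[OF assms] by (simp add: o_def)
qed

text \<open>The part of the argument that needs only real scalars, with compactness of
  \<open>K\<close> in sequential form. In the application, \<open>K\<close> and \<open>Q\<close>
  already carry the factor \<open>\<mu> ^ (-k)\<close>.\<close>

locale compact_perturbation =
  fixes A K Q :: "'a::banach \<Rightarrow> 'a"
  assumes A: "bounded_linear A" and Q: "bounded_linear Q" and inj: "inj A"
    and commute: "Q (A x) = A (Q x)"
    and K_eq: "K x = x + A (Q x)"
    and compact: "bounded (range y) \<Longrightarrow> \<exists>l r. strict_mono (r::nat\<Rightarrow>nat) \<and> (\<lambda>n. K (y (r n))) \<longlonglongrightarrow> l"
begin

lemma bounded_below: "\<exists>c>0. \<forall>x. c * norm x \<le> norm (A x)"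
proof (rule ccontr)
  assume "\<not> ?thesis"
  then have "\<exists>x. norm (A x) < inverse (real (Suc n)) * norm x" for n
    by (metis inverse_positive_iff_positive not_le of_nat_0_less_iff zero_less_Suc)
  then obtain x where x: "\<And>n. norm (A (x n)) < inverse (real (Suc n)) * norm (x n)" by metis
  have pos: "norm (x n) > 0" for n
    using x[of n] by (cases "x n = 0") (auto simp: linear_0[OF bounded_linear.linear[OF A]])
  define y where "y n = x n /\<^sub>R norm (x n)" for n
  have ny: "norm (y n) = 1" for n using pos[of n] by (simp add: y_def)
  have "norm (A (y n)) = norm (A (x n)) / norm (x n)" for n
    using pos[of n] by (simp add: y_def linear_cmul[OF bounded_linear.linear[OF A]] field_simps)
  then have "norm (A (y n)) \<le> inverse (real (Suc n))" for n
    using x[of n] pos[of n] by (simp add: divide_le_eq less_imp_le del: of_nat_Suc)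
  then have "(\<lambda>n. A (y n)) \<longlonglongrightarrow> 0"
    by (intro Lim_null_comparison[OF _ LIMSEQ_inverse_real_of_nat]) auto
  moreover have "bounded (range y)" by (auto simp: bounded_iff ny intro!: exI[of _ 1])
  from compact[OF this] obtain l r
    where r: "strict_mono (r::nat\<Rightarrow>nat)" "(\<lambda>n. K (y (r n))) \<longlonglongrightarrow> l" by blast
  ultimately have A0: "(\<lambda>n. A (y (r n))) \<longlonglongrightarrow> 0"
    using LIMSEQ_subseq_LIMSEQ[of "\<lambda>n. A (y n)" 0 r] by (simp add: o_def)
  have "(\<lambda>n. Q (A (y (r n)))) \<longlonglongrightarrow> 0"
    using bounded_linear.tendsto[OF Q A0] by (simp add: linear_0[OF bounded_linear.linear[OF Q]])
  \<comment> \<open>\<open>K_eq\<close> and \<open>commute\<close> give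
    \<open>K v - Q (A v) = v\<close>, so the limit of \<open>K (y (r n))\<close> is also that of
    \<open>y (r n)\<close>.\<close>
  from tendsto_diff[OF r(2) this] have yl: "(\<lambda>n. y (r n)) \<longlonglongrightarrow> l" by (simp add: K_eq commute)
  from tendsto_norm[OF this] have "norm l = 1" by (simp add: ny LIMSEQ_const_iff)
  moreover have "A l = 0" using bounded_linear.tendsto[OF A yl] A0 LIMSEQ_unique by blast
  then have "l = 0" using inj linear_0[OF bounded_linear.linear[OF A]] by (metis injD)
  ultimately show False by simp
qed

lemma subspace_range_funpow: "subspace (range (A ^^ n))"
  by (intro linear_subspace_image bounded_linear.linear bounded_linear_funpow A subspace_UNIV)

text \<open>A linear map that is bounded below sends complete subspaces to complete subspaces, so
  the induction carries completeness instead of closedness.\<close>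

lemma closed_range_funpow: "closed (range (A ^^ n))"
proof -
  obtain c where c: "c > 0" "\<And>x. c * norm x \<le> norm (A x)" using bounded_below by blast
  have "complete (range (A ^^ n))"
  proof (induction n)
    case 0
    show ?case by (simp add: complete_UNIV)
  next
    case (Suc n)
    have "complete (A ` range (A ^^ n))"
      using c Suc by (intro complete_isometric_image[OF c(1) subspace_range_funpow A]) (auto simp: mult.commute)
    then show ?case by (simp add: image_comp)
  qed
  then show ?thesis by (rule complete_imp_closed)
qed

lemma range_funpow_Suc_subset: "range (A ^^ Suc n) \<subseteq> range (A ^^ n)"
  unfolding funpow_Suc_right by auto

lemma surj: "surj A"
proof (rule ccontr)
  assume "\<not> surj A"
  then obtain z where z: "z \<notin> range A" by blast
  have "range (A ^^ Suc n) \<subset> range (A ^^ n)" for n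
  proof -
    \<comment> \<open>Cancelling the injective \<open>A ^^ n\<close> would put \<open>z\<close> into
      the range of \<open>A\<close>.\<close>
    have "(A ^^ n) z \<notin> range (A ^^ Suc n)"
    proof
      assume "(A ^^ n) z \<in> range (A ^^ Suc n)"
      then obtain w where "(A ^^ n) z = (A ^^ n) (A w)" unfolding funpow_Suc_right by auto
      moreover have "inj (A ^^ n)" using inj by (rule inj_fn)
      ultimately show False using z by (metis injD rangeI)
    qed
    then show ?thesis using range_funpow_Suc_subset by blast
  qed
  then have "\<exists>x \<in> range (A ^^ n). norm x = 1 \<and> (\<forall>s \<in> range (A ^^ Suc n). norm (x - s) \<ge> 1/2)" for n
    using Riesz_lemma[OF closed_range_funpow subspace_range_funpow subspace_range_funpow] by metis
  then obtain x where x: "\<And>n. x n \<in> range (A ^^ n)" "\<And>n. norm (x n) = 1"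
      "\<And>n s. s \<in> range (A ^^ Suc n) \<Longrightarrow> norm (x n - s) \<ge> 1/2"
    by metis
  \<comment> \<open>The difference equals \<open>x n - (K (x m) - A (Q (x n)))\<close>. The bracket
    lies in the range of \<open>A ^^ Suc n\<close>: \<open>K\<close> commutes with \<open>A\<close>,
    hence preserves the range of \<open>A ^^ m\<close>, and \<open>Suc n \<le> m\<close>.\<close>
  have sep: "norm (K (x n) - K (x m)) \<ge> 1/2" if "n < m" for n m
  proof -
    obtain u v where u: "x n = (A ^^ n) u" and v: "x m = (A ^^ m) v" using x(1) by blast
    have "A (Q (x n)) = (A ^^ Suc n) (Q u)"
      by (simp add: u funpow_commutes[of Q A, OF commute])
    then have 1: "A (Q (x n)) \<in> range (A ^^ Suc n)" by blast
    have "K (A y) = A (K y)" for y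
      by (simp add: K_eq commute linear_add[OF bounded_linear.linear[OF A]])
    then have "K (x m) = (A ^^ m) (K v)" by (simp add: v funpow_commutes)
    then have "K (x m) \<in> range (A ^^ m)" by blast
    moreover have "range (A ^^ m) \<subseteq> range (A ^^ Suc n)"
      using that by (intro lift_Suc_antimono_le[of "\<lambda>n. range (A ^^ n)", OF range_funpow_Suc_subset]) simp
    ultimately have "K (x m) - A (Q (x n)) \<in> range (A ^^ Suc n)"
      using 1 by (intro subspace_diff subspace_range_funpow) auto
    from x(3)[OF this] show ?thesis by (simp add: K_eq[of "x n"] algebra_simps)
  qed
  have "bounded (range x)" by (auto simp: bounded_iff x(2) intro!: exI[of _ 1])
  from compact[OF this] obtain l r
    where r: "strict_mono (r::nat\<Rightarrow>nat)" "(\<lambda>n. K (x (r n))) \<longlonglongrightarrow> l" by blast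
  then have "Cauchy (\<lambda>n. K (x (r n)))" using LIMSEQ_imp_Cauchy by blast
  then obtain N where "\<And>m n. m \<ge> N \<Longrightarrow> n \<ge> N \<Longrightarrow> norm (K (x (r m)) - K (x (r n))) < 1/2"
    unfolding Cauchy_iff by (metis half_gt_zero zero_less_one)
  from this[of N "Suc N"] sep[of "r N" "r (Suc N)"] r(1) show False
    by (simp add: strict_mono_Suc_iff)
qed

text \<open>The lower bound \<open>c\<close> for \<open>A\<close>, read at \<open>inv A x\<close>,
  bounds the inverse by \<open>1/c\<close>.\<close>

lemma bounded_linear_inv: "bounded_linear (inv A)"
proof -
  obtain c where c: "c > 0" "\<And>x. c * norm x \<le> norm (A x)" using bounded_below by blast
  have [simp]: "A (inv A x) = x" for x using surj surj_f_inv_f by metis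
  have inv_eq: "inv A y = x" if "A x = y" for x y using that inj by auto
  show ?thesis
  proof (rule bounded_linear_intro)
    show "inv A (x + y) = inv A x + inv A y" for x y
      by (rule inv_eq) (simp add: linear_add[OF bounded_linear.linear[OF A]])
    show "inv A (r *\<^sub>R x) = r *\<^sub>R inv A x" for r x
      by (rule inv_eq) (simp add: linear_cmul[OF bounded_linear.linear[OF A]])
    show "norm (inv A x) \<le> norm x * inverse c" for x
      using c(1) c(2)[of "inv A x"] by (simp add: field_simps)
  qed
qed

end

lemma bounded_linear_scaleC: "bounded_linear (\<lambda>x::'a::complex_banach. c *\<^sub>C x)"
  by (rule bounded_linear_intro[where K = "cmod c"])
    (simp_all add: scaleC_add_right norm_scaleC mult.commute scaleC_scaleC flip: scaleC_of_real)

lemma scaleC_diff_right: "c *\<^sub>C (x - y) = c *\<^sub>C x - c *\<^sub>C (y::'a::complex_banach)"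
  by (rule linear_diff[OF bounded_linear.linear[OF bounded_linear_scaleC]])

lemma bounded_clinear_shifted: "bounded_clinear T \<Longrightarrow> bounded_clinear (shifted T \<mu>)"
  unfolding bounded_clinear_def shifted_def
  by (auto intro!: bounded_linear_sub bounded_linear_scaleC simp: scaleC_diff_right scaleC_scaleC mult.commute)

text \<open>Division of \<open>t ^ k - \<mu> ^ k\<close> by \<open>t - \<mu>\<close>: the quotient
  is the sum of \<open>\<mu> ^ (k-1-j) T ^ j\<close> over \<open>j < k\<close>, built by the
  recursion from \<open>Q\<close> to \<open>\<mu> ^ k + T Q\<close>. Being a polynomial in
  \<open>T\<close>, it commutes with \<open>T\<close>.\<close>

lemma funpow_eq_power_plus_shifted:
  assumes T: "bounded_clinear T"
  shows "\<exists>Q. bounded_clinear Q \<and> (\<forall>x. Q (T x) = T (Q x)) \<and>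
    (\<forall>x. (T ^^ k) x = (\<mu> ^ k) *\<^sub>C x + shifted T \<mu> (Q x))"
proof -
  have T_lin: "linear T" and scale: "T (c *\<^sub>C x) = c *\<^sub>C T x" for c x
    using T by (auto simp: bounded_clinear_def dest: bounded_linear.linear)
  show ?thesis
  proof (induction k)
    case 0
    show ?case
      by (intro exI[of _ "\<lambda>_. 0"])
        (simp add: bounded_clinear_def shifted_def scaleC_one bounded_linear_zero T_lin[THEN linear_0]
          linear_0[OF bounded_linear.linear[OF bounded_linear_scaleC]])
  next
    case (Suc k)
    then obtain Q where Q: "bounded_clinear Q" "\<And>x. Q (T x) = T (Q x)"
      "\<And>x. (T ^^ k) x = (\<mu> ^ k) *\<^sub>C x + shifted T \<mu> (Q x)" by blast
    show ?case
    proof (intro exI[of _ "\<lambda>x. (\<mu> ^ k) *\<^sub>C x + T (Q x)"] conjI allI)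
      show "bounded_clinear (\<lambda>x. (\<mu> ^ k) *\<^sub>C x + T (Q x))"
        using T Q(1) unfolding bounded_clinear_def
        by (auto intro!: bounded_linear_add bounded_linear_scaleC bounded_linear_compose[of T]
            simp: scaleC_add_right scaleC_scaleC mult.commute)
      show "(\<mu> ^ k) *\<^sub>C T x + T (Q (T x)) = T ((\<mu> ^ k) *\<^sub>C x + T (Q x))" for x
        by (simp add: linear_add[OF T_lin] scale Q(2))
      show "(T ^^ Suc k) x = (\<mu> ^ Suc k) *\<^sub>C x + shifted T \<mu> ((\<mu> ^ k) *\<^sub>C x + T (Q x))" for x
        by (simp add: Q(3) shifted_def linear_add[OF T_lin] linear_diff[OF T_lin] scale scaleC_add_right scaleC_scaleC algebra_simps)
    qed
  qed
qed

lemma compact_operator_subseq: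
  fixes K :: "'a::complex_banach \<Rightarrow> 'b::complex_banach" and y :: "nat \<Rightarrow> 'a"
  assumes "compact_operator K" "bounded (range y)"
  obtains l r where "strict_mono (r::nat\<Rightarrow>nat)" "(\<lambda>n. K (y (r n))) \<longlonglongrightarrow> l"
proof -
  have "compact (closure (K ` range y))" using assms unfolding compact_operator_def by blast
  moreover have "K (y n) \<in> closure (K ` range y)" for n
    by (rule subsetD[OF closure_subset]) simp
  ultimately obtain l r where "strict_mono (r::nat\<Rightarrow>nat)" "((\<lambda>n. K (y n)) \<circ> r) \<longlonglongrightarrow> l"
    using seq_compactE[OF compact_imp_seq_compact, of _ "\<lambda>n. K (y n)"] by metis
  then show thesis using that by (auto simp: o_def)
qed

theorem theorem1p1:
  fixes T :: "'a::complex_banach \<Rightarrow> 'a" and \<mu> :: complex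
  assumes "bounded_clinear T"
    and "power_compact T"
    and "\<mu> \<noteq> 0"
    and "\<not> eigenvalue T \<mu>"
  shows "has_bounded_inverse (shifted T \<mu>)"
proof -
  let ?A = "shifted T \<mu>"
  obtain k where K: "compact_operator (T ^^ k)" using assms(2) unfolding power_compact_def by blast
  obtain Q where Q: "bounded_clinear Q" "\<And>x. Q (T x) = T (Q x)"
    "\<And>x. (T ^^ k) x = (\<mu> ^ k) *\<^sub>C x + ?A (Q x)"
    using funpow_eq_power_plus_shifted[OF assms(1)] by blast
  \<comment> \<open>Scaling by \<open>c\<close> turns the leading term \<open>\<mu> ^ k\<close> into
    the identity, as \<open>K_eq\<close> demands; this is where \<open>\<mu> \<noteq> 0\<close>
    enters.\<close>
  define c where "c = inverse (\<mu> ^ k)"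
  have c: "c * \<mu> ^ k = 1" using assms(3) by (simp add: c_def)
  have A: "bounded_linear ?A" and A_scale: "?A (a *\<^sub>C x) = a *\<^sub>C ?A x" for a x
    using bounded_clinear_shifted[OF assms(1)] by (auto simp: bounded_clinear_def)
  have Q_lin: "bounded_linear Q" and Q_scale: "Q (a *\<^sub>C x) = a *\<^sub>C Q x" for a x
    using Q(1) by (auto simp: bounded_clinear_def)
  interpret compact_perturbation ?A "\<lambda>x. c *\<^sub>C (T ^^ k) x" "\<lambda>x. c *\<^sub>C Q x"
  proof (rule compact_perturbation.intro)
    show "bounded_linear ?A" by (rule A)
    show "bounded_linear (\<lambda>x. c *\<^sub>C Q x)"
      by (intro bounded_linear_compose[OF bounded_linear_scaleC] Q_lin)
    show "inj ?A"
      using assms(4) unfolding eigenvalue_def linear_injective_0[OF bounded_linear.linear[OF A]] by blast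
    show "c *\<^sub>C Q (?A x) = ?A (c *\<^sub>C Q x)" for x
      unfolding A_scale by (simp add: shifted_def linear_diff[OF bounded_linear.linear[OF Q_lin]] Q(2) Q_scale)
    show "c *\<^sub>C (T ^^ k) x = x + ?A (c *\<^sub>C Q x)" for x
      by (simp add: Q(3) A_scale scaleC_add_right scaleC_scaleC c scaleC_one)
    show "\<exists>l r. strict_mono (r::nat\<Rightarrow>nat) \<and> (\<lambda>n. c *\<^sub>C (T ^^ k) (y (r n))) \<longlonglongrightarrow> l"
      if y: "bounded (range y)" for y
    proof -
      obtain l r where "strict_mono (r::nat\<Rightarrow>nat)" "(\<lambda>n. (T ^^ k) (y (r n))) \<longlonglongrightarrow> l"
        using compact_operator_subseq[OF K y] .
      with bounded_linear.tendsto[OF bounded_linear_scaleC] show ?thesis by blast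
    qed
  qed
  \<comment> \<open>The locale yields only real linearity of the inverse; complex homogeneity is
    inherited from the bijection \<open>?A\<close>.\<close>
  have "inv ?A (a *\<^sub>C x) = a *\<^sub>C inv ?A x" for a x
    by (metis A_scale inj inv_f_f surj surj_f_inv_f)
  then have "bounded_clinear (inv ?A)" using bounded_linear_inv by (simp add: bounded_clinear_def)
  then show ?thesis
    unfolding has_bounded_inverse_def
    using inj[unfolded inj_iff] surj[unfolded surj_iff] by (intro exI[of _ "inv ?A"]) simp
qed

end
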